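(* Let $(a_0,a_1,a_2,\dots)$ be an infinite sequence of nonnegative integers and let $n\ge 0$. Then $\Delta(a_0,\dots,a_n)$ is a triangle whose vertices are $\hat{X}_{n-1}$, $\hat{X}_n$ and $X_n \hat{+} X_{n-2}$.
   Context: Let $\Delta=\{(x,y)\in\mathbb{R}^2: 1\ge x\ge y>0\}$. For each integer $k\ge 0$ let $\Delta_k=\{(x,y)\in\Delta: 1-x-ky\ge 0> 1-x-(k+1)y\}$; these sets partition $\Delta$. The triangle map $T:\Delta\to\Delta\cup\{(t,0):0\le t\le 1\}$ is $T(\alpha,\beta)=\left(\frac{\beta}{\alpha},\frac{1-\alpha-k\beta}{\alpha}\right)$ for $(\alpha,\beta)\in\Delta_k$. For nonnegative integers $a_0,\dots,a_n$, $\Delta(a_0,\dots,a_n)=\{(x,y)\in\Delta: T^k(x,y)\in\Delta_{a_k}\text{ for all }0\le k\le n\}$. Given the sequence $(a_k)$, define vectors in $\mathbb{R}^3$ by $C_{-3}=(1,0,0)$, $C_{-2}=(0,1,0)$, $C_{-1}=(0,0,1)$, $C_k=C_{k-3}-C_{k-2}-a_kC_{k-1}$ for $k\ge 0$, and $X_k=C_k\times C_{k+1}$ (cross product) for $k\ge -3$; write $X_k=(x_k,y_k,z_k)$. For a vector $V=(a,b,c)$ with $a\neq 0$, $\hat V$ denotes the point $(b/a,c/a)\in\mathbb{R}^2$; for $V=(a,b,c)$, $W=(d,e,f)$ with $a+d\ne 0$, $V\hat{+}W$ denotes the point $\left(\frac{b+e}{a+d},\frac{c+f}{a+d}\right)\in\mathbb{R}^2$.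 *)

theory Defs
  imports "HOL-Analysis.Analysis"
begin

definition Delta :: "(real \<times> real) set" where
  "Delta = {(x, y). 1 \<ge> x \<and> x \<ge> y \<and> y > 0}"

definition Delta_part :: "nat \<Rightarrow> (real \<times> real) set" where
  "Delta_part k = {(x, y) \<in> Delta. 1 - x - real k * y \<ge> 0 \<and> 0 > 1 - x - (real k + 1) * y}"

lemma Delta_part_unique:
  assumes "p \<in> Delta_part k" "p \<in> Delta_part l"
  shows "k = l"
proof -
  obtain x y where p: "p = (x, y)" by (cases p)
  have y: "y > 0" using assms by (auto simp: p Delta_part_def Delta_def)
  have "real k * y < (real l + 1) * y" "real l * y < (real k + 1) * y"
    using assms by (auto simp: p Delta_part_def)
  then have "real k < real l + 1" "real l < real k + 1"
    using y by (auto simp only: mult_less_cancel_right_pos)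
  then show ?thesis by linarith
qed

lemma Delta_part_exists:
  assumes "p \<in> Delta"
  shows "\<exists>k. p \<in> Delta_part k"
proof -
  obtain x y where p: "p = (x, y)" by (cases p)
  have xy: "1 \<ge> x" "y > 0" using assms by (auto simp: p Delta_def)
  define k where "k = nat \<lfloor>(1 - x) / y\<rfloor>"
  have nn: "(1 - x) / y \<ge> 0" using xy by simp
  then have "real k = of_int \<lfloor>(1 - x) / y\<rfloor>" by (simp add: k_def)
  then have "real k \<le> (1 - x) / y" "(1 - x) / y < real k + 1" by linarith+
  then have "real k * y \<le> 1 - x" "1 - x < (real k + 1) * y"
    using xy by (simp_all only: pos_le_divide_eq pos_divide_less_eq)
  then have "p \<in> Delta_part k" using assms by (simp add: p Delta_part_def)
  then show ?thesis ..
qed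

(* The map is only meaningful on Delta: there the index k exists and is unique
   by the two lemmas above. *)
definition triangle_map :: "real \<times> real \<Rightarrow> real \<times> real" where
  "triangle_map p =
     (if p \<in> Delta
      then let k = (THE k. p \<in> Delta_part k)
           in (snd p / fst p, (1 - fst p - real k * snd p) / fst p)
      else undefined)"

lemma triangle_map_eq:
  assumes "(\<alpha>, \<beta>) \<in> Delta_part k"
  shows "triangle_map (\<alpha>, \<beta>) = (\<beta> / \<alpha>, (1 - \<alpha> - real k * \<beta>) / \<alpha>)"
proof -
  have "(THE j. (\<alpha>, \<beta>) \<in> Delta_part j) = k"
    using assms Delta_part_unique by blast
  moreover have "(\<alpha>, \<beta>) \<in> Delta" using assms by (simp add: Delta_part_def)
  ultimately show ?thesis by (simp add: triangle_map_def)
qed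

(* If the iterates 0, ..., n all lie in the required pieces, then the map has only
   been applied to points of Delta, so its value outside Delta is irrelevant here. *)
definition Delta_seq :: "(nat \<Rightarrow> nat) \<Rightarrow> nat \<Rightarrow> (real \<times> real) set" where
  "Delta_seq a n = {p \<in> Delta. \<forall>k\<le>n. (triangle_map ^^ k) p \<in> Delta_part (a k)}"

(* C_shift a m is the vector with index m - 3; Cvec restores the original indexing,
   which starts at -3 (indices below -3 are not used). *)
fun C_shift :: "(nat \<Rightarrow> nat) \<Rightarrow> nat \<Rightarrow> real^3" where
  "C_shift a 0 = vector [1, 0, 0]"
| "C_shift a (Suc 0) = vector [0, 1, 0]"
| "C_shift a (Suc (Suc 0)) = vector [0, 0, 1]"
| "C_shift a (Suc (Suc (Suc m))) =
     C_shift a m - C_shift a (Suc m) - real (a m) *\<^sub>R C_shift a (Suc (Suc m))"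

definition Cvec :: "(nat \<Rightarrow> nat) \<Rightarrow> int \<Rightarrow> real^3" where
  "Cvec a k = C_shift a (nat (k + 3))"

lemma Cvec_init:
  "Cvec a (-3) = vector [1, 0, 0]"
  "Cvec a (-2) = vector [0, 1, 0]"
  "Cvec a (-1) = vector [0, 0, 1]"
  by (simp_all add: Cvec_def numeral_2_eq_2)

lemma Cvec_rec:
  assumes "k \<ge> 0"
  shows "Cvec a k = Cvec a (k - 3) - Cvec a (k - 2) - real (a (nat k)) *\<^sub>R Cvec a (k - 1)"
proof -
  have "nat (k + 3) = Suc (Suc (Suc (nat k)))" "nat (k - 2 + 3) = Suc (nat k)"
    "nat (k - 1 + 3) = Suc (Suc (nat k))"
    using assms by linarith+
  then show ?thesis by (simp add: Cvec_def)
qed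

definition Xvec :: "(nat \<Rightarrow> nat) \<Rightarrow> int \<Rightarrow> real^3" where
  "Xvec a k = cross3 (Cvec a k) (Cvec a (k + 1))"

definition hat :: "real^3 \<Rightarrow> real \<times> real" where
  "hat V = (V $ 2 / V $ 1, V $ 3 / V $ 1)"

definition hat_plus :: "real^3 \<Rightarrow> real^3 \<Rightarrow> real \<times> real" where
  "hat_plus V W = ((V $ 2 + W $ 2) / (V $ 1 + W $ 1), (V $ 3 + W $ 3) / (V $ 1 + W $ 1))"

(* A nondegenerate triangle that may lack part of its boundary: Delta itself does not
   contain its bottom edge, and the pieces Delta_part k are half-open. *)
definition triangle_with_vertices ::
    "(real \<times> real) set \<Rightarrow> real \<times> real \<Rightarrow> real \<times> real \<Rightarrow> real \<times> real \<Rightarrow> bool" where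
  "triangle_with_vertices S A B C \<longleftrightarrow>
     \<not> collinear {A, B, C} \<and>
     interior (convex hull {A, B, C}) \<subseteq> S \<and> S \<subseteq> convex hull {A, B, C}"

end

(* Pair each C_k with the vector (1, x, y) to get numbers d_k. The iterate T^k (x, y) is
   (d_(k-2) / d_(k-3), d_(k-1) / d_(k-3)), and the recurrence
   d_(k-3) = d_(k-2) + a_k d_(k-1) + d_k propagates the inequalities
   d_(n-2) \<ge> d_(n-1) \<ge> d_n \<ge> 0 back to all smaller indices. So up to boundary points these three
   inequalities describe Delta(a_0, ..., a_n). On X_(n-1), X_n, X_n + X_(n-2) the triple
   (d_(n-2), d_(n-1), d_n) takes the values (1,0,0), (1,1,0), (1,1,1), so
   d_(n-2) - d_(n-1), d_(n-1) - d_n, d_n are, up to scaling, the barycentric coordinates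
   with respect to the three vertices. *)
theory Submission
  imports Defs
begin

text \<open>Homogeneous coordinates: affine functions of \<open>p\<close> become linear functionals
  of \<open>lift p\<close>.\<close>

definition lift :: "real \<times> real \<Rightarrow> real^3" where
  "lift p = vector [1, fst p, snd p]"

lemma lift_affine:
  assumes "u + v = 1"
  shows "lift (u *\<^sub>R p + v *\<^sub>R q) = u *\<^sub>R lift p + v *\<^sub>R lift q"
  using assms by (simp add: lift_def vec_eq_iff forall_3)

lemma lift_affine3:
  assumes "u + v + w = 1"
  shows "lift (u *\<^sub>R p + v *\<^sub>R q + w *\<^sub>R r) = u *\<^sub>R lift p + v *\<^sub>R lift q + w *\<^sub>R lift r"
  using assms by (simp add: lift_def vec_eq_iff forall_3)

lemma lift_hat: "V $ 1 \<noteq> 0 \<Longrightarrow> lift (hat V) = (1 / V $ 1) *\<^sub>R V"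
  by (simp add: lift_def hat_def vec_eq_iff forall_3)

lemma inj_lift: "lift p = lift q \<Longrightarrow> p = q"
  by (auto simp: lift_def vec_eq_iff forall_3 prod_eq_iff)

lemma hat_plus_eq_hat: "hat_plus V W = hat (V + W)"
  by (simp add: hat_def hat_plus_def)

text \<open>Solved for the oldest term, the recurrence has nonnegative coefficients, so inequalities
  pass to smaller indices.\<close>

lemma C_shift_inner_rec:
  "C_shift a m \<bullet> w =
     C_shift a (m + 1) \<bullet> w + real (a m) * (C_shift a (m + 2) \<bullet> w) + C_shift a (m + 3) \<bullet> w"
  by (simp add: eval_nat_numeral inner_diff_left)

lemma C_shift_inner_init:
  "C_shift a 0 \<bullet> w = w $ 1" "C_shift a 1 \<bullet> w = w $ 2" "C_shift a 2 \<bullet> w = w $ 3"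
  by (simp_all add: eval_nat_numeral inner_vec_def sum_3)

lemma C_shift_inner_lift_0: "C_shift a 0 \<bullet> lift p = 1"
  by (simp add: C_shift_inner_init lift_def del: C_shift.simps)

text \<open>Each use of the recurrence moves the chain of inequalities one index down. As
  \<open>C_shift a 0\<close> reads off the first coordinate, this bounds that coordinate from
  below.\<close>

lemma rec_decreasing:
  fixes e :: "nat \<Rightarrow> real" and a :: "nat \<Rightarrow> nat"
  assumes rec: "\<And>m. e m = e (m + 1) + real (a m) * e (m + 2) + e (m + 3)"
    and "e (n + 1) \<ge> e (n + 2)" "e (n + 2) \<ge> e (n + 3)" "e (n + 3) \<ge> 0"
  shows "e 0 \<ge> e (n + 1)"
  using assms(2-)
proof (induction n)
  case 0
  then show ?case using rec[of 0] by simp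
next
  case (Suc n)
  have "e (n + 1) = e (n + 2) + real (a (n + 1)) * e (n + 3) + e (n + 4)"
    using rec[of "n + 1"] by (simp add: eval_nat_numeral)
  moreover have "real (a (n + 1)) * e (n + 3) \<ge> 0"
    using Suc.prems by (simp add: eval_nat_numeral)
  moreover have ge: "e (n + 2) \<ge> e (n + 3)" "e (n + 3) \<ge> e (n + 4)" "e (n + 4) \<ge> 0"
    using Suc.prems by (simp_all add: eval_nat_numeral)
  ultimately have "e (n + 1) \<ge> e (n + 2)" by linarith
  with Suc.IH ge have "e 0 \<ge> e (n + 1)" by linarith
  with \<open>e (n + 1) \<ge> e (n + 2)\<close> show ?case by simp
qed

lemma rec_strictly_decreasing:
  fixes e :: "nat \<Rightarrow> real" and a :: "nat \<Rightarrow> nat"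
  assumes rec: "\<And>m. e m = e (m + 1) + real (a m) * e (m + 2) + e (m + 3)"
    and last: "e (n + 1) > e (n + 2)" "e (n + 2) > e (n + 3)" "e (n + 3) > 0"
    and "k \<le> n"
  shows "e k > e (k + 1) \<and> e (k + 1) > e (k + 2) \<and> e (k + 2) > e (k + 3) \<and> e (k + 3) > 0"
  using \<open>k \<le> n\<close>
proof (induction k rule: inc_induct)
  case base
  have "real (a n) * e (n + 2) \<ge> 0" using last by simp
  then show ?case using last rec[of n] by linarith
next
  case (step k)
  have "real (a k) * e (k + 2) \<ge> 0" using step.IH by (simp add: eval_nat_numeral)
  moreover have "e (k + 1) > e (k + 2)" "e (k + 2) > e (k + 3)" "e (k + 3) > 0"
    using step.IH by (simp_all add: eval_nat_numeral)
  ultimately show ?case using rec[of k] by linarith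
qed

text \<open>Descending the recurrence makes \<open>w\<close> orthogonal to the standard basis, so
  three consecutive \<open>C_shift\<close> vectors span the space.\<close>

lemma C_shift_inner_eq_0:
  assumes "C_shift a (n + 1) \<bullet> w = 0" "C_shift a (n + 2) \<bullet> w = 0" "C_shift a (n + 3) \<bullet> w = 0"
  shows "w = 0"
  using assms
proof (induction n)
  case 0
  then show ?case
    using C_shift_inner_rec[of a 0 w] C_shift_inner_init[of a w]
    by (simp add: vec_eq_iff forall_3 numeral_2_eq_2 del: C_shift.simps)
next
  case (Suc n)
  then show ?case
    using C_shift_inner_rec[of a "n + 1" w] by (simp add: eval_nat_numeral del: C_shift.simps)
qed

lemma Delta_part_quotient_iff:
  fixes r s t :: real
  assumes "r > 0"
  shows "(s / r, t / r) \<in> Delta_part k \<longleftrightarrow>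
    r \<ge> s \<and> s \<ge> t \<and> t > 0 \<and> r - s - real k * t \<ge> 0 \<and> r - s - real k * t < t"
proof -
  have eqs: "1 - s / r - real k * (t / r) = (r - s - real k * t) / r"
    "1 - s / r - (real k + 1) * (t / r) = (r - s - real k * t - t) / r"
    using assms by (simp_all add: field_simps)
  show ?thesis
    unfolding Delta_part_def Delta_def mem_Collect_eq case_prod_conv eqs
    using assms by (auto simp: divide_le_cancel zero_less_divide_iff zero_le_divide_iff divide_less_0_iff)
qed

text \<open>On homogeneous coordinates the map is linear, taking (r, s, t) to (s, t, r - s - k t),
  the same step as in the recurrence for the vectors C.\<close>

lemma triangle_map_quotient:
  fixes r s t :: real
  assumes "r > 0" "(s / r, t / r) \<in> Delta_part k"
  shows "triangle_map (s / r, t / r) = (t / s, (r - s - real k * t) / s)"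
proof -
  have "s > 0" using assms Delta_part_quotient_iff[of r s t k] by linarith
  with assms show ?thesis by (simp add: triangle_map_eq field_simps)
qed

context
  fixes a :: "nat \<Rightarrow> nat" and p :: "real \<times> real" and e :: "nat \<Rightarrow> real"
  defines "e \<equiv> \<lambda>m. C_shift a m \<bullet> lift p"
begin

lemma e_rec: "e m = e (m + 1) + real (a m) * e (m + 2) + e (m + 3)"
  unfolding e_def by (rule C_shift_inner_rec)

text \<open>The digit is \<open>a k\<close> exactly when the remainder \<open>e (k + 3)\<close> lies
  in the half-open range from 0 to \<open>e (k + 2)\<close>.\<close>

lemma e_quotient_mem_Delta_part_iff:
  assumes "e k > 0"
  shows "(e (k + 1) / e k, e (k + 2) / e k) \<in> Delta_part (a k) \<longleftrightarrow>
    e k \<ge> e (k + 1) \<and> e (k + 1) \<ge> e (k + 2) \<and> e (k + 2) > 0 \<and> e (k + 3) \<ge> 0 \<and> e (k + 3) < e (k + 2)"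
proof -
  have "e k - e (k + 1) - real (a k) * e (k + 2) = e (k + 3)" using e_rec[of k] by simp
  then show ?thesis by (simp only: Delta_part_quotient_iff[OF assms])
qed

text \<open>Only memberships strictly before \<open>k\<close> are assumed, so that the formula can
  serve to prove the membership at \<open>k\<close>.\<close>

lemma triangle_map_iterate:
  assumes "\<And>j. j < k \<Longrightarrow> (triangle_map ^^ j) p \<in> Delta_part (a j)"
  shows "e k > 0 \<and> (triangle_map ^^ k) p = (e (k + 1) / e k, e (k + 2) / e k)"
  using assms
proof (induction k)
  case 0
  have "e 0 = 1" "e 1 = fst p" "e 2 = snd p"
    using C_shift_inner_init[of a "lift p"] by (simp_all add: e_def lift_def del: C_shift.simps)
  then show ?case by (simp add: eval_nat_numeral)
next
  case (Suc k)
  then have pos: "e k > 0"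
    and orbit: "(triangle_map ^^ k) p = (e (k + 1) / e k, e (k + 2) / e k)"
    by simp_all
  have mem: "(e (k + 1) / e k, e (k + 2) / e k) \<in> Delta_part (a k)"
    using Suc.prems[of k] orbit by simp
  then have "e (k + 1) > 0" using e_quotient_mem_Delta_part_iff[OF pos] by linarith
  moreover have "e k - e (k + 1) - real (a k) * e (k + 2) = e (k + 3)" using e_rec[of k] by simp
  ultimately show ?case
    using orbit triangle_map_quotient[OF pos mem] by (simp add: eval_nat_numeral)
qed

lemma Delta_seq_imp_decreasing:
  assumes "p \<in> Delta_seq a n"
  shows "e (n + 1) \<ge> e (n + 2) \<and> e (n + 2) \<ge> e (n + 3) \<and> e (n + 3) \<ge> 0"
proof -
  have mem: "\<And>j. j \<le> n \<Longrightarrow> (triangle_map ^^ j) p \<in> Delta_part (a j)"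
    using assms by (simp add: Delta_seq_def)
  have "e n > 0" "(triangle_map ^^ n) p = (e (n + 1) / e n, e (n + 2) / e n)"
    using triangle_map_iterate[of n] mem by simp_all
  then show ?thesis using mem[of n] e_quotient_mem_Delta_part_iff[of n] by simp
qed

text \<open>Strictness avoids the sides missing from the half-open pieces. Earlier memberships
  identify the next iterate, and the propagated inequalities place it in its piece.\<close>

lemma decreasing_imp_Delta_seq:
  assumes "e (n + 1) > e (n + 2)" "e (n + 2) > e (n + 3)" "e (n + 3) > 0"
  shows "p \<in> Delta_seq a n"
proof -
  have mem: "(triangle_map ^^ k) p \<in> Delta_part (a k)" if "k \<le> n" for k
    using that
  proof (induction k rule: less_induct)
    case (less k)
    then have "e k > 0" "(triangle_map ^^ k) p = (e (k + 1) / e k, e (k + 2) / e k)"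
      using triangle_map_iterate[of k] by simp_all
    then show ?case
      using rec_strictly_decreasing[OF e_rec assms less.prems] e_quotient_mem_Delta_part_iff[of k]
      by simp
  qed
  from mem[of 0] have "p \<in> Delta" by (auto simp: Delta_part_def)
  with mem show ?thesis by (simp add: Delta_seq_def)
qed

end

text \<open>This is a determinant: one step of the recurrence permutes the rows cyclically and adds
  multiples of two rows to the third.\<close>

lemma C_shift_triple_product:
  "C_shift a m \<bullet> cross3 (C_shift a (m + 1)) (C_shift a (m + 2)) = 1"
proof (induction m)
  case 0
  show ?case by (simp add: eval_nat_numeral cross3_def inner_vec_def sum_3)
next
  case (Suc m)
  have "v \<bullet> cross3 w (u - v - c *\<^sub>R w) = u \<bullet> cross3 v w" for u v w :: "real^3" and c :: real
    by (simp add: cross3_def inner_vec_def sum_3 algebra_simps)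
  with Suc.IH show ?case by (simp add: eval_nat_numeral)
qed

theorem theorem3:
  fixes a :: "nat \<Rightarrow> nat" and n :: nat
  shows "Xvec a (int n - 1) $ 1 \<noteq> 0 \<and>
         Xvec a (int n) $ 1 \<noteq> 0 \<and>
         Xvec a (int n) $ 1 + Xvec a (int n - 2) $ 1 \<noteq> 0 \<and>
         triangle_with_vertices (Delta_seq a n)
           (hat (Xvec a (int n - 1)))
           (hat (Xvec a (int n)))
           (hat_plus (Xvec a (int n)) (Xvec a (int n - 2)))"
proof -
  define U V W where "U = Xvec a (int n - 1)" and "V = Xvec a (int n)"
    and "W = Xvec a (int n) + Xvec a (int n - 2)"
  define c1 c2 c3 where "c1 = C_shift a (n + 1)" and "c2 = C_shift a (n + 2)"
    and "c3 = C_shift a (n + 3)"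
  have c4: "C_shift a (n + 4) = c1 - c2 - real (a (n + 1)) *\<^sub>R c3"
    by (simp add: c1_def c2_def c3_def eval_nat_numeral)
  \<comment> \<open>All indices here are at least -2, so \<open>nat\<close> in \<open>Cvec\<close>
    truncates nothing.\<close>
  have Xvec_shift: "Xvec a (int n - 2 + int i) = cross3 (C_shift a (n + i + 1)) (C_shift a (n + i + 2))"
    for i
  proof -
    have "nat (int n - 2 + int i + 3) = n + i + 1" "nat (int n - 2 + int i + 1 + 3) = n + i + 2"
      by linarith+
    then show ?thesis by (simp only: Xvec_def Cvec_def)
  qed
  have X: "U = cross3 c2 c3" "V = cross3 c3 (c1 - c2 - real (a (n + 1)) *\<^sub>R c3)"
    "W = V + cross3 c1 c2"
    unfolding U_def V_def W_def c4[symmetric] unfolding c1_def c2_def c3_def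
    using Xvec_shift[of 0] Xvec_shift[of 1] Xvec_shift[of 2]
    by (simp_all add: numeral_eq_Suc del: C_shift.simps)
  have triple: "c1 \<bullet> cross3 c2 c3 = 1"
    using C_shift_triple_product[of a "n + 1"]
    by (simp add: c1_def c2_def c3_def eval_nat_numeral del: C_shift.simps)
  \<comment> \<open>The digit \<open>a (n + 1)\<close> lies beyond the given ones; it drops out
    because the cross product of \<open>c3\<close> with itself is 0.\<close>
  have cyc: "cross3 c3 (c1 - c2 - real (a (n + 1)) *\<^sub>R c3) = cross3 c3 c1 + cross3 c2 c3"
    by (simp add: cross3_def vec_eq_iff forall_3 algebra_simps)
  have triple': "c2 \<bullet> cross3 c3 c1 = 1" "c3 \<bullet> cross3 c1 c2 = 1"
    using triple by (simp_all add: cross3_def inner_vec_def sum_3 algebra_simps)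
  \<comment> \<open>Thus \<open>c1 - c2\<close>, \<open>c2 - c3\<close>, \<open>c3\<close> form the
    basis dual to \<open>U\<close>, \<open>V\<close>, \<open>W\<close>.\<close>
  have dual: "c1 \<bullet> U = 1" "c2 \<bullet> U = 0" "c3 \<bullet> U = 0"
    "c1 \<bullet> V = 1" "c2 \<bullet> V = 1" "c3 \<bullet> V = 0"
    "c1 \<bullet> W = 1" "c2 \<bullet> W = 1" "c3 \<bullet> W = 1"
    unfolding X(3) unfolding X cyc
    by (simp_all add: inner_add_right triple triple' dot_cross_self)
  have ge1: "Y $ 1 \<ge> 1"
    if "c1 \<bullet> Y = 1" "c1 \<bullet> Y \<ge> c2 \<bullet> Y" "c2 \<bullet> Y \<ge> c3 \<bullet> Y" "c3 \<bullet> Y \<ge> 0" for Y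
    using rec_decreasing[where e = "\<lambda>m. C_shift a m \<bullet> Y", OF C_shift_inner_rec, of n] that
    by (simp add: c1_def c2_def c3_def C_shift_inner_init(1) del: C_shift.simps)
  have pos: "U $ 1 > 0" "V $ 1 > 0" "W $ 1 > 0"
    using ge1[of U] ge1[of V] ge1[of W] dual by simp_all
  define A B C where "A = hat U" and "B = hat V" and "C = hat W"
  have lifts: "lift A = (1 / U $ 1) *\<^sub>R U" "lift B = (1 / V $ 1) *\<^sub>R V" "lift C = (1 / W $ 1) *\<^sub>R W"
    unfolding A_def B_def C_def using pos by (intro lift_hat; simp)+
  have nc: "\<not> collinear {A, B, C}"
  proof
    assume "collinear {A, B, C}"
    \<comment> \<open>The functional \<open>c3\<close> vanishes at \<open>A\<close> but not at
      \<open>C\<close>; \<open>c2 - c3\<close> vanishes at both but not at \<open>B\<close>.\<close>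
    then consider "A = C" | u where "B = u *\<^sub>R A + (1 - u) *\<^sub>R C"
      by (auto simp: collinear_3_expand)
    then show False
    proof cases
      case 1
      then have "c3 \<bullet> lift A = c3 \<bullet> lift C" by simp
      then show False using pos by (simp add: lifts dual)
    next
      case 2
      then have "(c2 - c3) \<bullet> lift B = (c2 - c3) \<bullet> (u *\<^sub>R lift A + (1 - u) *\<^sub>R lift C)"
        by (simp add: lift_affine)
      then show False using pos by (simp add: lifts dual inner_diff_left inner_add_right)
    qed
  qed
  have "interior (convex hull {A, B, C}) \<subseteq> Delta_seq a n"
  proof
    fix p assume "p \<in> interior (convex hull {A, B, C})"
    then obtain x y z where xyz: "x > 0" "y > 0" "z > 0" "x + y + z = 1"
      and "p = x *\<^sub>R A + y *\<^sub>R B + z *\<^sub>R C"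
      using interior_convex_hull_3_minimal[OF nc] by auto
    then have p: "lift p = (x / U $ 1) *\<^sub>R U + (y / V $ 1) *\<^sub>R V + (z / W $ 1) *\<^sub>R W"
      by (simp add: lift_affine3 lifts)
    have "c1 \<bullet> lift p > c2 \<bullet> lift p" "c2 \<bullet> lift p > c3 \<bullet> lift p" "c3 \<bullet> lift p > 0"
      using xyz pos by (simp_all add: p inner_add_right dual)
    then show "p \<in> Delta_seq a n"
      unfolding c1_def c2_def c3_def by (rule decreasing_imp_Delta_seq)
  qed
  moreover have "Delta_seq a n \<subseteq> convex hull {A, B, C}"
  proof
    fix p assume "p \<in> Delta_seq a n"
    then have dec: "c1 \<bullet> lift p \<ge> c2 \<bullet> lift p" "c2 \<bullet> lift p \<ge> c3 \<bullet> lift p" "c3 \<bullet> lift p \<ge> 0"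
      using Delta_seq_imp_decreasing[of p a n] by (simp_all add: c1_def c2_def c3_def del: C_shift.simps)
    \<comment> \<open>Pairing with the dual basis gives the coordinates of \<open>lift p\<close> in
      terms of \<open>U\<close>, \<open>V\<close>, \<open>W\<close>.\<close>
    define q r s where "q = c1 \<bullet> lift p - c2 \<bullet> lift p" and "r = c2 \<bullet> lift p - c3 \<bullet> lift p"
      and "s = c3 \<bullet> lift p"
    have "lift p - (q *\<^sub>R U + r *\<^sub>R V + s *\<^sub>R W) = 0"
      by (rule C_shift_inner_eq_0[of a n]; fold c1_def c2_def c3_def)
        (simp_all add: inner_diff_right inner_add_right dual q_def r_def s_def)
    then have p: "lift p = q *\<^sub>R U + r *\<^sub>R V + s *\<^sub>R W" by simp
    \<comment> \<open>Since \<open>U\<close> is \<open>U $ 1\<close> times \<open>lift A\<close>,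
      and likewise for \<open>V\<close> and \<open>W\<close>, this rescaling yields barycentric
      coordinates; they sum to 1, the first entry of \<open>lift p\<close>.\<close>
    define x y z where "x = q * U $ 1" and "y = r * V $ 1" and "z = s * W $ 1"
    have nn: "x \<ge> 0" "y \<ge> 0" "z \<ge> 0"
      using dec pos by (simp_all add: x_def y_def z_def q_def r_def s_def)
    have "lift p $ 1 = x + y + z" by (simp add: p x_def y_def z_def)
    then have sum: "x + y + z = 1" by (simp add: lift_def)
    then have "lift (x *\<^sub>R A + y *\<^sub>R B + z *\<^sub>R C) = lift p"
      using pos by (simp add: lift_affine3 lifts p x_def y_def z_def)
    then have "p = x *\<^sub>R A + y *\<^sub>R B + z *\<^sub>R C" by (metis inj_lift)
    with nn sum show "p \<in> convex hull {A, B, C}" by (auto simp: convex_hull_3)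
  qed
  ultimately have "triangle_with_vertices (Delta_seq a n) A B C"
    using nc by (simp add: triangle_with_vertices_def)
  then show ?thesis
    using pos by (simp add: A_def B_def C_def U_def V_def W_def hat_plus_eq_hat)
qed

end
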